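(* Let $n\ge 1$, $0<\rho<1$, and let $s,t\ge 0$ be reals. Let $S,T\subseteq\{-1,1\}^n$ with $|S|=\exp(-s^2/2)\,2^n$ and $|T|=\exp(-t^2/2)\,2^n$. Let $x$ be chosen uniformly at random from $\{-1,1\}^n$ and let $y$ be a $\rho$-correlated copy of $x$. Then $$\Pr[x\in S,\ y\in T]\ \ge\ \exp\left(-\frac12\,\frac{s^2+2\rho st+t^2}{1-\rho^2}\right).$$
   Context: Given $x\in\{-1,1\}^n$, a $\rho$-correlated copy $y$ of $x$ is the random string in $\{-1,1\}^n$ obtained by flipping each coordinate of $x$ independently with probability $\tfrac12-\tfrac12\rho$ (so that $\mathbf{E}[x_iy_i]=\rho$ independently for each $i$). *)

theory Defs
  imports "HOL-Probability.Probability"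
begin

text \<open>
  The discrete cube of \<open>n\<close>-bit sign strings. Strings are functions on \<open>{..<n}\<close> that are
  \<open>undefined\<close> elsewhere, so that the cube has exactly \<open>2 ^ n\<close> elements.
\<close>

definition cube :: "nat \<Rightarrow> (nat \<Rightarrow> int) set" where
  "cube n = {..<n} \<rightarrow>\<^sub>E {-1, 1}"

text \<open>
  The flip probability is chosen so that \<open>x i * y i\<close> has expectation \<open>\<rho>\<close>. The default value \<open>undefined\<close> outside \<open>{..<n}\<close> keeps
  the copy inside the cube.
\<close>

definition correlated_copy :: "nat \<Rightarrow> real \<Rightarrow> (nat \<Rightarrow> int) \<Rightarrow> (nat \<Rightarrow> int) pmf" where
  "correlated_copy n \<rho> x =
     Pi_pmf {..<n} undefined
       (\<lambda>i. map_pmf (\<lambda>flip. if flip then - x i else x i) (bernoulli_pmf (1/2 - \<rho>/2)))"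

definition correlated_pair :: "nat \<Rightarrow> real \<Rightarrow> ((nat \<Rightarrow> int) \<times> (nat \<Rightarrow> int)) pmf" where
  "correlated_pair n \<rho> =
     bind_pmf (pmf_of_set (cube n)) (\<lambda>x. map_pmf (\<lambda>y. (x, y)) (correlated_copy n \<rho> x))"

end

theory Submission
  imports Defs
begin

text \<open>
  The bound is the reverse small-set expansion inequality, and it comes from reverse
  hypercontractivity: for exponents \<open>p\<close>, \<open>q\<close> in \<open>(0, 1)\<close> with
  \<open>(1 - p) * (1 - q) = \<rho>\<^sup>2\<close> and nonnegative \<open>f\<close>, \<open>g\<close>, the expectation of \<open>f x * g y\<close> over a
  \<open>\<rho>\<close>-correlated pair is at least \<open>\<parallel>f\<parallel>\<^sub>p * \<parallel>g\<parallel>\<^sub>q\<close>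
  (\<open>reverse_hypercontractivity\<close>). For indicators of \<open>S\<close> and \<open>T\<close> the right-hand side is
  \<open>exp (- (s\<^sup>2 / p + t\<^sup>2 / q) / 2)\<close>, and the best choice of \<open>p\<close> and \<open>q\<close> on the curve gives
  the claimed exponent (\<open>prob_ge_of_pos\<close>).

  The bilinear inequality tensorizes: conditioning on the last coordinate of both strings
  applies the \<open>n\<close>-dimensional case to the four pairs of restrictions of \<open>f\<close> and \<open>g\<close>, and what
  remains is the one-dimensional case for their norms (\<open>two_point_bilinear\<close>).

  In one dimension the noise operator \<open>T\<^sub>\<rho>\<close>, which averages over a correlated copy, factors
  as \<open>T\<^sub>\<sigma> T\<^sub>\<tau>\<close> with \<open>\<sigma>\<^sup>2 = 1 - p\<close> and \<open>\<tau>\<^sup>2 = 1 - q\<close>. Since \<open>T\<^sub>\<sigma>\<close> is symmetric, the expectation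
  equals that of the product of \<open>T\<^sub>\<sigma> f\<close> and \<open>T\<^sub>\<tau> g\<close>, which is at least the product of their
  geometric means. So the exponent \<open>0\<close> separates the two functions, and only the statement
  about one function is left that the geometric mean of \<open>T\<^sub>\<sigma> f\<close> is at least \<open>\<parallel>f\<parallel>\<^sub>p\<close>
  (\<open>two_point\<close>). For \<open>f\<close> with values proportional to \<open>exp w\<close> and \<open>exp (- w)\<close> it says
  \<open>cosh (p * w) ^ 2 \<le> (1 + p * sinh w ^ 2) powr p\<close>, a calculus exercise.
\<close>

section \<open>The two-point inequality\<close>

lemma sinh_scale_le:
  fixes j k w :: real
  assumes "0 < j" "j \<le> k" "0 \<le> w"
  shows "k * sinh (j * w) \<le> j * sinh (k * w)"
proof -
  define F where "F = (\<lambda>w. j * sinh (k * w) - k * sinh (j * w))"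
  have "F 0 \<le> F w"
  proof (rule DERIV_nonneg_imp_nondecreasing[OF \<open>0 \<le> w\<close>])
    fix x :: real assume x: "0 \<le> x" "x \<le> w"
    have "(F has_real_derivative j * k * (cosh (k * x) - cosh (j * x))) (at x)"
      unfolding F_def by (auto intro!: derivative_eq_intros simp: algebra_simps)
    moreover have "cosh (j * x) \<le> cosh (k * x)"
      using assms x by (subst cosh_real_nonneg_le_iff) (auto intro: mult_right_mono)
    hence "0 \<le> j * k * (cosh (k * x) - cosh (j * x))"
      using assms by simp
    ultimately show "\<exists>y. (F has_real_derivative y) (at x) \<and> 0 \<le> y" by blast
  qed
  thus ?thesis by (simp add: F_def)
qed

text \<open>
  Both sides agree at \<open>w = 0\<close>, so it is enough to compare derivatives. After clearing
  denominators and using the addition theorem for \<open>sinh (2 * w - p * w)\<close>, the comparison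
  becomes \<open>(2 - p) * sinh (p * w) \<le> p * sinh ((2 - p) * w)\<close>, which holds because
  \<open>p \<le> 2 - p\<close> and \<open>sinh (k * w) / k\<close> increases with \<open>k\<close>.
\<close>

lemma ln_cosh_le_nonneg:
  fixes p w :: real
  assumes "0 < p" "p < 1" "0 \<le> w"
  shows "2 * ln (cosh (p * w)) \<le> p * ln (1 + p * (sinh w)\<^sup>2)"
proof -
  define D where "D = (\<lambda>w. p * ln (1 + p * (sinh w)\<^sup>2) - 2 * ln (cosh (p * w)))"
  have "D 0 \<le> D w"
  proof (rule DERIV_nonneg_imp_nondecreasing[OF \<open>0 \<le> w\<close>])
    fix x :: real assume x: "0 \<le> x" "x \<le> w"
    have pos: "0 < 1 + p * (sinh x)\<^sup>2" using assms by (simp add: add_pos_nonneg)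
    have c: "0 < cosh (p * x)" by simp
    have "(D has_real_derivative
            p * (2 * p * sinh x * cosh x / (1 + p * (sinh x)\<^sup>2)) -
            2 * (p * sinh (p * x) / cosh (p * x))) (at x)"
      unfolding D_def using pos c
      by (auto intro!: derivative_eq_intros simp: field_simps)
    moreover have "0 \<le> p * (2 * p * sinh x * cosh x / (1 + p * (sinh x)\<^sup>2)) -
            2 * (p * sinh (p * x) / cosh (p * x))"
    proof -
      have "(2 - p) * sinh (p * x) \<le> p * sinh ((2 - p) * x)"
        by (rule sinh_scale_le) (use assms x in auto)
      also have "sinh ((2 - p) * x) = sinh (2 * x) * cosh (p * x) - cosh (2 * x) * sinh (p * x)"
        by (simp add: left_diff_distrib sinh_diff)
      also have "\<dots> = 2 * sinh x * cosh x * cosh (p * x) - (1 + 2 * (sinh x)\<^sup>2) * sinh (p * x)"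
        by (simp only: sinh_double cosh_double cosh_square_eq) (simp add: algebra_simps)
      finally have "sinh (p * x) * (1 + p * (sinh x)\<^sup>2) \<le> p * sinh x * cosh x * cosh (p * x)"
        by (simp add: algebra_simps)
      hence "sinh (p * x) / cosh (p * x) \<le> p * sinh x * cosh x / (1 + p * (sinh x)\<^sup>2)"
        using pos c by (simp add: divide_simps mult.commute)
      hence "2 * p * (sinh (p * x) / cosh (p * x)) \<le>
             2 * p * (p * sinh x * cosh x / (1 + p * (sinh x)\<^sup>2))"
        using assms by (intro mult_left_mono) auto
      thus ?thesis by (simp add: algebra_simps)
    qed
    ultimately show "\<exists>y. (D has_real_derivative y) (at x) \<and> 0 \<le> y" by blast
  qed
  thus ?thesis by (simp add: D_def)
qed

lemma ln_cosh_le: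
  fixes p w :: real
  assumes "0 < p" "p < 1"
  shows "2 * ln (cosh (p * w)) \<le> p * ln (1 + p * (sinh w)\<^sup>2)"
  using ln_cosh_le_nonneg[of p w] ln_cosh_le_nonneg[of p "-w"] assms
  by (cases "0 \<le> w") auto

lemma two_point_exp:
  fixes p w :: real
  assumes "0 < p" "p < 1"
  shows "((exp w powr p + exp (-w) powr p) / 2) powr (1 / p) \<le> sqrt (1 + p * (sinh w)\<^sup>2)"
proof -
  have pos: "0 < 1 + p * (sinh w)\<^sup>2" using assms by (simp add: add_pos_nonneg)
  have "((exp w powr p + exp (-w) powr p) / 2) powr (1 / p) = cosh (p * w) powr (1 / p)"
    by (simp add: cosh_def powr_def scaleR_conv_of_real)
  also have "\<dots> = exp (ln (cosh (p * w)) / p)"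
    by (simp add: powr_def)
  also have "\<dots> \<le> exp (ln (1 + p * (sinh w)\<^sup>2) / 2)"
    using ln_cosh_le[OF assms, of w] assms by (simp add: field_simps)
  also have "\<dots> = sqrt (1 + p * (sinh w)\<^sup>2)"
    using pos by (simp add: ln_sqrt flip: powr_half_sqrt add: powr_def)
  finally show ?thesis .
qed

text \<open>
  The right-hand side is the geometric mean of the two values of \<open>T\<^sub>\<sigma> f\<close>, where \<open>f\<close> takes
  the values \<open>a\<close>, \<open>b\<close> and \<open>\<sigma>\<^sup>2 = 1 - p\<close>. Both sides are homogeneous, so dividing by
  \<open>sqrt (a * b)\<close> reduces the claim to the values \<open>exp w\<close> and \<open>exp (- w)\<close>.
\<close>

lemma two_point_pos:
  fixes p a b :: real
  assumes "0 < p" "p < 1" "0 < a" "0 < b"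
  shows "((a powr p + b powr p) / 2) powr (1 / p)
           \<le> sqrt (((a + b) / 2)\<^sup>2 - (1 - p) * ((a - b) / 2)\<^sup>2)"
proof -
  define m where "m = sqrt (a * b)"
  define w where "w = (ln a - ln b) / 2"
  have m: "m > 0" "m = exp ((ln a + ln b) / 2)"
    using assms by (auto simp: m_def real_sqrt_mult exp_add add_divide_distrib ln_sqrt[symmetric])
  have a: "a = m * exp w" and b: "b = m * exp (-w)"
    unfolding m(2) w_def exp_add[symmetric] using assms by (simp_all add: field_simps)
  have "(a powr p + b powr p) / 2 = m powr p * ((exp w powr p + exp (-w) powr p) / 2)"
    using m(1) by (simp add: a b powr_mult field_simps)
  hence "((a powr p + b powr p) / 2) powr (1 / p)
      = m * ((exp w powr p + exp (-w) powr p) / 2) powr (1 / p)"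
    using m(1) assms by (simp only: powr_mult powr_powr) simp
  also have "\<dots> \<le> m * sqrt (1 + p * (sinh w)\<^sup>2)"
    using two_point_exp[OF assms(1,2)] m(1) by (intro mult_left_mono) auto
  also have "\<dots> = sqrt (m\<^sup>2 * (1 + p * (sinh w)\<^sup>2))"
    using m(1) by (simp add: real_sqrt_mult)
  also have "m\<^sup>2 * (1 + p * (sinh w)\<^sup>2) = (m * cosh w)\<^sup>2 - (1 - p) * (m * sinh w)\<^sup>2"
    by (simp add: power_mult_distrib cosh_square_eq algebra_simps)
  also have "m * cosh w = (a + b) / 2"
    by (simp add: a b cosh_def algebra_simps)
  also have "m * sinh w = (a - b) / 2"
    by (simp add: a b sinh_def algebra_simps)
  finally show ?thesis .
qed

text \<open>
  The boundary case \<open>b = 0\<close> has no exponential parametrization. It reduces to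
  \<open>2 powr (- 1 / p) \<le> sqrt p / 2\<close>, which follows from \<open>ln (1 / p) \<le> 1 / p - 1\<close> because
  \<open>1 \<le> 2 * ln 2\<close>.
\<close>

lemma two_point_zero:
  fixes p a :: real
  assumes "0 < p" "p < 1" "0 \<le> a"
  shows "(a powr p / 2) powr (1 / p) \<le> sqrt ((a / 2)\<^sup>2 - (1 - p) * (a / 2)\<^sup>2)"
proof -
  have "ln (1 / p) \<le> 1 / p - 1" using assms by (intro ln_le_minus_one) auto
  also have "\<dots> \<le> 2 * ((1 / p - 1) * ln 2)"
  proof -
    have "ln (1 / 2) \<le> (1 / 2 :: real) - 1" by (rule ln_le_minus_one) auto
    hence "1 \<le> 2 * ln (2::real)" by (simp add: ln_div)
    hence "(1 / p - 1) * 1 \<le> (1 / p - 1) * (2 * ln 2)"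
      using assms by (intro mult_left_mono) auto
    thus ?thesis by simp
  qed
  finally have "- (ln 2 / p) \<le> ln p / 2 - ln 2"
    using assms by (simp add: ln_div field_simps)
  hence "exp (- (ln 2 / p)) \<le> exp (ln p / 2 - ln 2)" by simp
  also have "\<dots> = sqrt p / 2"
    using assms by (simp add: exp_diff ln_sqrt[symmetric])
  finally have c: "(1 / 2) powr (1 / p) \<le> sqrt p / 2"
    by (simp add: powr_def ln_div)
  have "(a powr p / 2) powr (1 / p) = (a powr p * (1 / 2)) powr (1 / p)" by simp
  also have "\<dots> = a * (1 / 2) powr (1 / p)"
    using assms by (simp only: powr_mult powr_powr) simp
  also have "\<dots> \<le> a * (sqrt p / 2)" using c assms by (intro mult_left_mono) auto
  also have "\<dots> = sqrt (p * (a / 2)\<^sup>2)" using assms by (simp add: real_sqrt_mult)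
  also have "p * (a / 2)\<^sup>2 = (a / 2)\<^sup>2 - (1 - p) * (a / 2)\<^sup>2" by (simp add: algebra_simps)
  finally show ?thesis .
qed

lemma two_point:
  fixes p a b :: real
  assumes "0 < p" "p < 1" "0 \<le> a" "0 \<le> b"
  shows "((a powr p + b powr p) / 2) powr (1 / p)
           \<le> sqrt (((a + b) / 2)\<^sup>2 - (1 - p) * ((a - b) / 2)\<^sup>2)"
  using two_point_pos[of p a b] two_point_zero[of p a] two_point_zero[of p b] assms
  by (cases "a = 0"; cases "b = 0") auto

text \<open>
  The right-hand side is the expectation of the product of two functions with values
  \<open>a\<close>, \<open>b\<close> and \<open>c\<close>, \<open>d\<close> at a \<open>\<rho>\<close>-correlated pair of bits. In the proof, \<open>A\<close>, \<open>A'\<close> and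
  \<open>C\<close>, \<open>C'\<close> are the values of the first function smoothed by \<open>\<sigma>\<close> and of the second
  smoothed by \<open>\<tau>\<close>. As \<open>\<rho> = \<sigma> * \<tau>\<close>, the expectation is the arithmetic mean of \<open>A * C\<close> and
  \<open>A' * C'\<close>; their geometric mean splits into one factor for each function.
\<close>

lemma two_point_bilinear:
  fixes p q \<rho> a b c d :: real
  assumes "0 < p" "p < 1" "0 < q" "q < 1" "0 \<le> \<rho>" "\<rho>\<^sup>2 = (1 - p) * (1 - q)"
    and "0 \<le> a" "0 \<le> b" "0 \<le> c" "0 \<le> d"
  shows "((a powr p + b powr p) / 2) powr (1 / p) * ((c powr q + d powr q) / 2) powr (1 / q)
           \<le> (1 + \<rho>) / 4 * (a * c + b * d) + (1 - \<rho>) / 4 * (a * d + b * c)"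
proof -
  define \<sigma> \<tau> where "\<sigma> = sqrt (1 - p)" and "\<tau> = sqrt (1 - q)"
  have \<sigma>: "\<sigma>\<^sup>2 = 1 - p" "0 \<le> \<sigma>" "\<sigma> \<le> 1" and \<tau>: "\<tau>\<^sup>2 = 1 - q" "0 \<le> \<tau>" "\<tau> \<le> 1"
    using assms by (auto simp: \<sigma>_def \<tau>_def)
  have \<rho>: "\<rho> = \<sigma> * \<tau>"
    using assms \<sigma> \<tau> by (metis mult_nonneg_nonneg power2_eq_imp_eq power_mult_distrib)
  define A A' where "A = (a + b) / 2 + \<sigma> * ((a - b) / 2)" and "A' = (a + b) / 2 - \<sigma> * ((a - b) / 2)"
  define C C' where "C = (c + d) / 2 + \<tau> * ((c - d) / 2)" and "C' = (c + d) / 2 - \<tau> * ((c - d) / 2)"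
  have smooth_nonneg: "0 \<le> (u + v) / 2 + \<theta> * ((u - v) / 2)" "0 \<le> (u + v) / 2 - \<theta> * ((u - v) / 2)"
    if "0 \<le> u" "0 \<le> v" "0 \<le> \<theta>" "\<theta> \<le> 1" for u v \<theta> :: real
  proof -
    have "(u + v) / 2 + \<theta> * ((u - v) / 2) = (1 + \<theta>) / 2 * u + (1 - \<theta>) / 2 * v"
      "(u + v) / 2 - \<theta> * ((u - v) / 2) = (1 - \<theta>) / 2 * u + (1 + \<theta>) / 2 * v"
      by (simp_all add: field_simps)
    thus "0 \<le> (u + v) / 2 + \<theta> * ((u - v) / 2)" "0 \<le> (u + v) / 2 - \<theta> * ((u - v) / 2)"
      using that by simp_all
  qed
  have nn: "0 \<le> A" "0 \<le> A'" "0 \<le> C" "0 \<le> C'"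
    unfolding A_def A'_def C_def C'_def using assms \<sigma> \<tau> by (intro smooth_nonneg; simp)+
  have "((a + b) / 2)\<^sup>2 - (1 - p) * ((a - b) / 2)\<^sup>2 = A * A'"
    unfolding A_def A'_def \<sigma>(1)[symmetric] by (simp add: power2_eq_square algebra_simps)
  hence f: "((a powr p + b powr p) / 2) powr (1 / p) \<le> sqrt (A * A')"
    using two_point[of p a b] assms by simp
  have "((c + d) / 2)\<^sup>2 - (1 - q) * ((c - d) / 2)\<^sup>2 = C * C'"
    unfolding C_def C'_def \<tau>(1)[symmetric] by (simp add: power2_eq_square algebra_simps)
  hence g: "((c powr q + d powr q) / 2) powr (1 / q) \<le> sqrt (C * C')"
    using two_point[of q c d] assms by simp
  have "((a powr p + b powr p) / 2) powr (1 / p) * ((c powr q + d powr q) / 2) powr (1 / q)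
      \<le> sqrt (A * A') * sqrt (C * C')"
    using f g nn by (intro mult_mono) auto
  also have "\<dots> = sqrt ((A * C) * (A' * C'))"
    by (simp add: real_sqrt_mult[symmetric] mult_ac)
  also have "\<dots> \<le> (A * C + A' * C') / 2"
    using nn by (intro arith_geo_mean_sqrt) auto
  also have "\<dots> = (1 + \<rho>) / 4 * (a * c + b * d) + (1 - \<rho>) / 4 * (a * d + b * c)"
    unfolding A_def A'_def C_def C'_def \<rho> by (simp add: field_simps)
  finally show ?thesis .
qed

section \<open>Reverse hypercontractivity on the cube\<close>

lemma finite_cube [simp]: "finite (cube n)"
  by (auto simp: cube_def intro: finite_PiE)

lemma card_cube: "card (cube n) = 2 ^ n"
  by (simp add: cube_def card_PiE flip: numeral_2_eq_2)

lemma sum_cube_Suc: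
  "(\<Sum>x\<in>cube (Suc n). F x) = (\<Sum>x\<in>cube n. F (x(n := 1))) + (\<Sum>x\<in>cube n. F (x(n := -1)))"
  for F :: "(nat \<Rightarrow> int) \<Rightarrow> real"
proof -
  have "cube (Suc n) = (\<lambda>(a, x). x(n := a)) ` ({-1, 1} \<times> cube n)"
    by (simp add: cube_def lessThan_Suc PiE_insert_eq)
  moreover have "inj_on (\<lambda>(a, x). x(n := a)) ({-1, 1} \<times> cube n)"
    unfolding cube_def using inj_combinator[of n "{..<n}" "\<lambda>_. {-1, 1 :: int}"] by simp
  ultimately have "(\<Sum>x\<in>cube (Suc n). F x) = (\<Sum>(a, x)\<in>{-1, 1} \<times> cube n. F (x(n := a)))"
    by (simp add: sum.reindex case_prod_unfold)
  also have "\<dots> = (\<Sum>a\<in>{-1, 1}. \<Sum>x\<in>cube n. F (x(n := a)))"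
    by (simp add: sum.cartesian_product)
  finally show ?thesis by simp
qed

text \<open>
  The joint probability of \<open>x\<close> and its copy \<open>y\<close> on the cube: in each coordinate an equal
  pair of signs has probability \<open>(1 + \<rho>) / 4\<close> and an unequal pair \<open>(1 - \<rho>) / 4\<close>.
\<close>

definition pair_weight :: "nat \<Rightarrow> real \<Rightarrow> (nat \<Rightarrow> int) \<Rightarrow> (nat \<Rightarrow> int) \<Rightarrow> real" where
  "pair_weight n \<rho> x y = (\<Prod>i<n. (1 + \<rho> * of_int (x i * y i)) / 4)"

definition noise_form :: "nat \<Rightarrow> real \<Rightarrow> ((nat \<Rightarrow> int) \<Rightarrow> real) \<Rightarrow> ((nat \<Rightarrow> int) \<Rightarrow> real) \<Rightarrow> real" where
  "noise_form n \<rho> f g = (\<Sum>x\<in>cube n. \<Sum>y\<in>cube n. pair_weight n \<rho> x y * f x * g y)"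

text \<open>
  The \<open>L\<^sup>p\<close> norm with respect to the uniform distribution; for \<open>p < 1\<close> it is not a norm,
  but it remains homogeneous. It is meant for nonnegative \<open>f\<close>.
\<close>

definition power_mean :: "nat \<Rightarrow> real \<Rightarrow> ((nat \<Rightarrow> int) \<Rightarrow> real) \<Rightarrow> real" where
  "power_mean n p f = ((\<Sum>x\<in>cube n. f x powr p) / 2 ^ n) powr (1 / p)"

lemma power_mean_nonneg [simp]: "0 \<le> power_mean n p f"
  by (simp add: power_mean_def)

text \<open>
  The \<open>L\<^sup>p\<close> norm can be taken first over \<open>n\<close> coordinates and then over the last one; this and
  the same splitting of the noise form below make the induction on the dimension work.
\<close>

lemma power_mean_Suc:
  assumes "0 < p"
  shows "power_mean (Suc n) p f =
    ((power_mean n p (\<lambda>x. f (x(n := 1))) powr p + power_mean n p (\<lambda>x. f (x(n := -1))) powr p) / 2)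
      powr (1 / p)"
  using assms
  by (simp add: power_mean_def sum_cube_Suc powr_powr sum_nonneg add_divide_distrib mult.commute)

lemma noise_form_Suc:
  "noise_form (Suc n) \<rho> f g =
     (1 + \<rho>) / 4 *
       (noise_form n \<rho> (\<lambda>x. f (x(n := 1))) (\<lambda>y. g (y(n := 1))) +
        noise_form n \<rho> (\<lambda>x. f (x(n := -1))) (\<lambda>y. g (y(n := -1)))) +
     (1 - \<rho>) / 4 *
       (noise_form n \<rho> (\<lambda>x. f (x(n := 1))) (\<lambda>y. g (y(n := -1))) +
        noise_form n \<rho> (\<lambda>x. f (x(n := -1))) (\<lambda>y. g (y(n := 1))))"
proof -
  have w: "pair_weight (Suc n) \<rho> (x(n := a)) (y(n := b)) =
      (1 + \<rho> * of_int (a * b)) / 4 * pair_weight n \<rho> x y" for x y a b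
    by (simp add: pair_weight_def)
  show ?thesis
    unfolding noise_form_def sum_cube_Suc w
    by (simp add: sum.distrib sum_distrib_left distrib_left mult_ac)
qed

text \<open>
  The weights \<open>(1 + \<rho>) / 4\<close> and \<open>(1 - \<rho>) / 4\<close> are nonnegative, so the induction hypothesis can be
  applied inside them to each pair of restrictions of \<open>f\<close> and \<open>g\<close>. The two-point
  inequality then applies to the norms of these restrictions as functions of the last bit.
\<close>

theorem reverse_hypercontractivity:
  fixes p q \<rho> :: real
  assumes "0 < p" "p < 1" "0 < q" "q < 1" "0 \<le> \<rho>" "\<rho>\<^sup>2 = (1 - p) * (1 - q)"
    and "\<And>x. 0 \<le> f x" "\<And>y. 0 \<le> g y"
  shows "power_mean n p f * power_mean n q g \<le> noise_form n \<rho> f g"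
  using assms(7,8)
proof (induction n arbitrary: f g)
  case 0
  thus ?case
    using assms by (simp add: power_mean_def noise_form_def pair_weight_def cube_def powr_powr)
next
  case (Suc n)
  have "\<rho>\<^sup>2 \<le> 1" using assms mult_mono[of "1 - p" 1 "1 - q" 1] by simp
  hence "\<rho> \<le> 1" by (simp add: abs_square_le_1)
  let ?f = "\<lambda>a x. f (x(n := a))" and ?g = "\<lambda>a x. g (x(n := a))"
  have IH: "power_mean n p (?f a) * power_mean n q (?g b) \<le> noise_form n \<rho> (?f a) (?g b)" for a b
    by (rule Suc.IH) (use Suc.prems in auto)
  have "power_mean (Suc n) p f * power_mean (Suc n) q g \<le>
      (1 + \<rho>) / 4 * (power_mean n p (?f 1) * power_mean n q (?g 1) +
                     power_mean n p (?f (-1)) * power_mean n q (?g (-1))) +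
      (1 - \<rho>) / 4 * (power_mean n p (?f 1) * power_mean n q (?g (-1)) +
                     power_mean n p (?f (-1)) * power_mean n q (?g 1))"
    unfolding power_mean_Suc[OF \<open>0 < p\<close>] power_mean_Suc[OF \<open>0 < q\<close>]
    by (rule two_point_bilinear) (use assms in auto)
  also have "\<dots> \<le> noise_form (Suc n) \<rho> f g"
    unfolding noise_form_Suc using assms \<open>\<rho> \<le> 1\<close>
    by (intro add_mono mult_left_mono IH) auto
  finally show ?case .
qed

section \<open>Correlated pairs\<close>

lemma pmf_correlated_copy:
  assumes "x \<in> cube n" "y \<in> cube n" "\<bar>\<rho>\<bar> \<le> 1"
  shows "pmf (correlated_copy n \<rho> x) y = (\<Prod>i<n. (1 + \<rho> * of_int (x i * y i)) / 2)"
proof -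
  have "pmf (map_pmf (\<lambda>flip. if flip then - x i else x i) (bernoulli_pmf (1/2 - \<rho>/2))) (y i)
      = (1 + \<rho> * of_int (x i * y i)) / 2" if "i < n" for i
  proof -
    have x: "x i = 1 \<or> x i = -1" and y: "y i = 1 \<or> y i = -1"
      using assms that by (auto simp: cube_def PiE_iff)
    have inj: "inj (\<lambda>flip. if flip then - x i else x i)"
      using x by (auto simp: inj_def split: if_splits)
    have "y i = (if x i \<noteq> y i then - x i else x i)" using x y by auto
    hence "pmf (map_pmf (\<lambda>flip. if flip then - x i else x i) (bernoulli_pmf (1/2 - \<rho>/2))) (y i)
        = pmf (bernoulli_pmf (1/2 - \<rho>/2)) (x i \<noteq> y i)"
      using pmf_map_inj'[OF inj, of "bernoulli_pmf (1/2 - \<rho>/2)" "x i \<noteq> y i"] by simp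
    thus ?thesis using x y assms by (auto simp: field_simps)
  qed
  moreover have "y i = undefined" if "i \<notin> {..<n}" for i
    using assms that by (auto simp: cube_def PiE_iff extensional_def)
  ultimately show ?thesis
    unfolding correlated_copy_def by (subst pmf_Pi') (auto intro!: prod.cong simp del: of_int_mult)
qed

lemma pmf_correlated_pair:
  assumes "x \<in> cube n" "y \<in> cube n" "\<bar>\<rho>\<bar> \<le> 1"
  shows "pmf (correlated_pair n \<rho>) (x, y) = pair_weight n \<rho> x y"
proof -
  have ne: "cube n \<noteq> {}" using assms by auto
  have "pmf (map_pmf (\<lambda>y. (x', y)) (correlated_copy n \<rho> x')) (x, y) =
      (if x' = x then pmf (correlated_copy n \<rho> x) y else 0)" for x'
  proof (cases "x' = x")
    case True
    thus ?thesis using pmf_map_inj'[of "\<lambda>y. (x, y)" "correlated_copy n \<rho> x" y]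
      by (simp add: inj_def)
  next
    case False
    thus ?thesis by (auto simp: pmf_eq_0_set_pmf)
  qed
  hence "pmf (correlated_pair n \<rho>) (x, y) = pmf (correlated_copy n \<rho> x) y / 2 ^ n"
    unfolding correlated_pair_def using assms ne
    by (simp add: pmf_bind_pmf_of_set card_cube)
  also have "\<dots> = pair_weight n \<rho> x y"
    by (simp add: pmf_correlated_copy[OF assms] pair_weight_def prod_dividef power_mult_distrib[symmetric])
  finally show ?thesis .
qed

lemma prob_correlated_pair:
  assumes "S \<subseteq> cube n" "T \<subseteq> cube n" "\<bar>\<rho>\<bar> \<le> 1"
  shows "measure_pmf.prob (correlated_pair n \<rho>) {(x, y). x \<in> S \<and> y \<in> T}
           = noise_form n \<rho> (indicator S) (indicator T)"
proof -
  have fin: "finite S" "finite T" using assms by (auto intro: finite_subset)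
  have "{(x, y). x \<in> S \<and> y \<in> T} = S \<times> T" by auto
  hence "measure_pmf.prob (correlated_pair n \<rho>) {(x, y). x \<in> S \<and> y \<in> T}
      = (\<Sum>z\<in>S \<times> T. pmf (correlated_pair n \<rho>) z)"
    using fin by (simp add: measure_measure_pmf_finite)
  also have "\<dots> = (\<Sum>x\<in>S. \<Sum>y\<in>T. pair_weight n \<rho> x y)"
    unfolding sum.cartesian_product using assms by (intro sum.cong) (auto intro!: pmf_correlated_pair)
  also have "\<dots> = (\<Sum>x\<in>cube n. \<Sum>y\<in>cube n. pair_weight n \<rho> x y * indicator S x * indicator T y)"
    using assms fin
    by (intro sum.mono_neutral_cong_left) (auto intro!: sum.mono_neutral_cong_left)
  finally show ?thesis by (simp add: noise_form_def)
qed

lemma power_mean_indicator: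
  assumes "S \<subseteq> cube n"
  shows "power_mean n p (indicator S) = (real (card S) / 2 ^ n) powr (1 / p)"
proof -
  have "(\<Sum>x\<in>cube n. indicator S x powr p) = (\<Sum>x\<in>S. 1 :: real)"
    using assms by (intro sum.mono_neutral_cong_right) auto
  thus ?thesis by (simp add: power_mean_def)
qed

lemma prob_ge_powr:
  fixes p q \<rho> :: real
  assumes "0 < p" "p < 1" "0 < q" "q < 1" "0 \<le> \<rho>" "\<rho>\<^sup>2 = (1 - p) * (1 - q)"
    and "S \<subseteq> cube n" "T \<subseteq> cube n"
  shows "(real (card S) / 2 ^ n) powr (1 / p) * (real (card T) / 2 ^ n) powr (1 / q)
    \<le> measure_pmf.prob (correlated_pair n \<rho>) {(x, y). x \<in> S \<and> y \<in> T}"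
proof -
  have "\<rho>\<^sup>2 \<le> 1" using assms mult_mono[of "1 - p" 1 "1 - q" 1] by simp
  hence "\<bar>\<rho>\<bar> \<le> 1" by (simp add: abs_square_le_1)
  thus ?thesis
    using reverse_hypercontractivity[OF assms(1-6), of "indicator S" "indicator T" n] assms(7,8)
    unfolding prob_correlated_pair[OF assms(7,8) \<open>\<bar>\<rho>\<bar> \<le> 1\<close>] by (simp add: power_mean_indicator)
qed

text \<open>
  Write \<open>1 - p = \<rho> * r\<close> and \<open>1 - q = \<rho> / r\<close>. Minimizing \<open>s\<^sup>2 / p + t\<^sup>2 / q\<close> over \<open>r\<close> gives
  \<open>r = (t + \<rho> * s) / (s + \<rho> * t)\<close>, and these are the \<open>p\<close> and \<open>q\<close> used here. They are
  positive only for positive \<open>s\<close> and \<open>t\<close>. The sizes of \<open>S\<close> and \<open>T\<close> are bounded below rather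
  than given exactly, so that \<open>s\<close> and \<open>t\<close> may be enlarged.
\<close>

lemma prob_ge_of_pos:
  fixes \<rho> s t :: real
  assumes "0 < \<rho>" "\<rho> < 1" "0 < s" "0 < t"
    and "S \<subseteq> cube n" "T \<subseteq> cube n"
    and "exp (- s\<^sup>2 / 2) \<le> real (card S) / 2 ^ n" "exp (- t\<^sup>2 / 2) \<le> real (card T) / 2 ^ n"
  shows "exp (- (1/2) * ((s\<^sup>2 + 2 * \<rho> * s * t + t\<^sup>2) / (1 - \<rho>\<^sup>2)))
    \<le> measure_pmf.prob (correlated_pair n \<rho>) {(x, y). x \<in> S \<and> y \<in> T}"
proof -
  define p where "p = s * (1 - \<rho>\<^sup>2) / (s + \<rho> * t)"
  define q where "q = t * (1 - \<rho>\<^sup>2) / (t + \<rho> * s)"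
  have \<rho>2: "\<rho>\<^sup>2 < 1" using assms by (simp add: abs_square_less_1)
  have den: "0 < s + \<rho> * t" "0 < t + \<rho> * s" using assms by (simp_all add: add_pos_pos)
  have p1: "1 - p = \<rho> * (t + \<rho> * s) / (s + \<rho> * t)"
    using den by (simp add: p_def field_simps power2_eq_square)
  have q1: "1 - q = \<rho> * (s + \<rho> * t) / (t + \<rho> * s)"
    using den by (simp add: q_def field_simps power2_eq_square)
  have "0 < 1 - p" "0 < 1 - q" unfolding p1 q1 using den assms by simp_all
  moreover have "0 < p" "0 < q" using den \<rho>2 assms by (simp_all add: p_def q_def)
  moreover have "\<rho>\<^sup>2 = (1 - p) * (1 - q)"
    unfolding p1 q1 using den by (simp add: power2_eq_square)
  ultimately have *: "(real (card S) / 2 ^ n) powr (1 / p) * (real (card T) / 2 ^ n) powr (1 / q)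
      \<le> measure_pmf.prob (correlated_pair n \<rho>) {(x, y). x \<in> S \<and> y \<in> T}"
    using assms by (intro prob_ge_powr) auto
  have "s\<^sup>2 / p = s * (s + \<rho> * t) / (1 - \<rho>\<^sup>2)" "t\<^sup>2 / q = t * (t + \<rho> * s) / (1 - \<rho>\<^sup>2)"
    using assms by (simp_all add: p_def q_def power2_eq_square)
  hence "s\<^sup>2 / p + t\<^sup>2 / q = (s\<^sup>2 + 2 * \<rho> * s * t + t\<^sup>2) / (1 - \<rho>\<^sup>2)"
    by (simp add: add_divide_distrib[symmetric] power2_eq_square algebra_simps)
  hence "exp (- (1/2) * ((s\<^sup>2 + 2 * \<rho> * s * t + t\<^sup>2) / (1 - \<rho>\<^sup>2)))
      = exp (- s\<^sup>2 / 2) powr (1 / p) * exp (- t\<^sup>2 / 2) powr (1 / q)"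
    by (simp add: powr_def exp_add[symmetric] flip: \<open>s\<^sup>2 / p + t\<^sup>2 / q = _\<close>)
       (simp add: field_simps)
  also have "\<dots> \<le> (real (card S) / 2 ^ n) powr (1 / p) * (real (card T) / 2 ^ n) powr (1 / q)"
    using assms \<open>0 < p\<close> \<open>0 < q\<close> by (intro mult_mono powr_mono2) auto
  also note *
  finally show ?thesis .
qed

text \<open>
  The optimal \<open>p\<close> or \<open>q\<close> degenerates to \<open>0\<close> when \<open>s\<close> or \<open>t\<close> vanishes. Replacing \<open>s\<close> and \<open>t\<close> by
  \<open>s + \<epsilon>\<close> and \<open>t + \<epsilon>\<close> avoids this, and the bound is continuous as \<open>\<epsilon>\<close> tends to \<open>0\<close>.
\<close>

theorem theorem3p4:
  fixes n :: nat and \<rho> s t :: real and S T :: "(nat \<Rightarrow> int) set"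
  assumes "n \<ge> 1"
    and "0 < \<rho>" and "\<rho> < 1"
    and "s \<ge> 0" and "t \<ge> 0"
    and "S \<subseteq> cube n" and "T \<subseteq> cube n"
    and "real (card S) = exp (- s\<^sup>2 / 2) * 2 ^ n"
    and "real (card T) = exp (- t\<^sup>2 / 2) * 2 ^ n"
  shows "measure_pmf.prob (correlated_pair n \<rho>) {(x, y). x \<in> S \<and> y \<in> T}
           \<ge> exp (- (1/2) * ((s\<^sup>2 + 2 * \<rho> * s * t + t\<^sup>2) / (1 - \<rho>\<^sup>2)))"
proof -
  define B where "B = (\<lambda>\<epsilon>. exp (- (1/2) *
    (((s + \<epsilon>)\<^sup>2 + 2 * \<rho> * (s + \<epsilon>) * (t + \<epsilon>) + (t + \<epsilon>)\<^sup>2) / (1 - \<rho>\<^sup>2))))"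
  have "\<rho>\<^sup>2 < 1" using assms by (simp add: abs_square_less_1)
  hence "isCont B 0" unfolding B_def by (intro continuous_intros) auto
  hence "(B \<longlongrightarrow> B 0) (at_right 0)"
    by (auto simp: isCont_def intro: filterlim_at_split[THEN iffD1, THEN conjunct2])
  moreover have "B \<epsilon> \<le> measure_pmf.prob (correlated_pair n \<rho>) {(x, y). x \<in> S \<and> y \<in> T}"
    if "0 < \<epsilon>" for \<epsilon>
  proof -
    have "s\<^sup>2 \<le> (s + \<epsilon>)\<^sup>2" "t\<^sup>2 \<le> (t + \<epsilon>)\<^sup>2"
      using assms that by (auto intro: power_mono)
    thus ?thesis
      unfolding B_def using assms that by (intro prob_ge_of_pos) auto
  qed
  hence "eventually (\<lambda>\<epsilon>. B \<epsilon> \<le>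
      measure_pmf.prob (correlated_pair n \<rho>) {(x, y). x \<in> S \<and> y \<in> T}) (at_right 0)"
    by (auto simp: eventually_at_filter)
  ultimately have "B 0 \<le> measure_pmf.prob (correlated_pair n \<rho>) {(x, y). x \<in> S \<and> y \<in> T}"
    by (intro tendsto_upperbound) auto
  thus ?thesis by (simp add: B_def)
qed

end
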